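(* Let $\overline{D}\subset\mathbb{C}$ be a closed disc with centre at $0$, let $F:\overline{D}\to\mathbb{C}$ be continuous, and let $\zeta\in\overline{D}$. Suppose there exist a constant $p\geq 2$, a nowhere-vanishing function $A\in\mathcal{O}(\overline{D})$, and functions $G,H\in\mathcal{O}_\zeta(\overline{D})$ such that $$|A(z)F(z)-A(\zeta)F(\zeta)+G(z)|^p\ \leq\ \mathrm{Re}\left[H(z)\bigl(A(z)F(z)-A(\zeta)F(\zeta)+G(z)\bigr)\right]\quad\text{for all } z\in\overline{D}.$$ Then $$\widehat{\Gamma_{\overline{D}}(F)}\ \subset\ \left\{(z,w)\in\overline{D}\times\mathbb{C}: |A(z)w-A(\zeta)F(\zeta)+G(z)|\leq|H(z)|^{1/(p-1)}\right\}.$$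
   Context: $\mathcal{O}(\overline{D})$ is the set of functions that are holomorphic on some (not necessarily fixed) open neighbourhood of $\overline{D}$; for $\zeta\in\overline{D}$, $\mathcal{O}_\zeta(\overline{D})$ is the set of functions in $\mathcal{O}(\overline{D})$ that vanish at $\zeta$. $\Gamma_{\overline{D}}(F):=\{(z,F(z)):z\in\overline{D}\}\subset\mathbb{C}^2$. For a compact set $X\subset\mathbb{C}^n$, $\widehat{X}$ denotes its polynomially convex hull $\widehat{X}=\{x\in\mathbb{C}^n: |p(x)|\leq\sup_X|p| \text{ for every holomorphic polynomial } p\}$. *)

theory Defs
  imports "HOL-Complex_Analysis.Complex_Analysis"
begin

text \<open>
  Germs on \<open>K\<close> are represented by total functions; their values outside
  a neighbourhood of \<open>K\<close> are irrelevant.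
\<close>

definition hol_nbhd :: "complex set \<Rightarrow> (complex \<Rightarrow> complex) set" where
  "hol_nbhd K = {f. \<exists>U. open U \<and> K \<subseteq> U \<and> f holomorphic_on U}"

definition hol_nbhd_vanishing :: "complex \<Rightarrow> complex set \<Rightarrow> (complex \<Rightarrow> complex) set" where
  "hol_nbhd_vanishing \<zeta> K = {f \<in> hol_nbhd K. f \<zeta> = 0}"

definition graph_over :: "complex set \<Rightarrow> (complex \<Rightarrow> complex) \<Rightarrow> (complex ^ 2) set" where
  "graph_over K F = {vector [z, F z] | z. z \<in> K}"

text \<open>
  Holomorphic polynomials on \<open>\<complex>\<^sup>n\<close>: finite linear combinations of monomials,
  where the function \<open>\<alpha>\<close> is a multi-index.
\<close>

definition holomorphic_polynomial :: "(complex ^ 'n \<Rightarrow> complex) \<Rightarrow> bool" where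
  "holomorphic_polynomial q \<longleftrightarrow>
     (\<exists>(S :: ('n \<Rightarrow> nat) set) c. finite S \<and>
        (\<forall>x. q x = (\<Sum>\<alpha>\<in>S. c \<alpha> * (\<Prod>i\<in>UNIV. (x $ i) ^ \<alpha> i))))"

text \<open>
  Intended for nonempty compact \<open>X\<close>; otherwise the real-valued supremum
  below may be unspecified.
\<close>

definition poly_hull :: "(complex ^ 'n) set \<Rightarrow> (complex ^ 'n) set" where
  "poly_hull X = {x. \<forall>q. holomorphic_polynomial q \<longrightarrow> cmod (q x) \<le> (SUP y\<in>X. cmod (q y))}"

end

theory Submission
  imports Defs
begin

text \<open>
  Put \<open>W = A w - A(\<zeta>) F(\<zeta>) + G\<close>. The function \<open>|W|\<^sup>p - Re (H W)\<close> is plurisubharmonic near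
  \<open>cball 0 r \<times> \<complex>\<close> and nonpositive on the graph, hence nonpositive on the hull, and there
  \<open>|W|\<^sup>p \<le> Re (H W) \<le> |H| |W|\<close> gives the claim. To see the nonpositivity at one point of the
  hull, replace \<open>|W|\<^sup>p\<close> by its tangent there: by convexity this only decreases the function, and
  what remains is the real part of a function that is holomorphic in \<open>z\<close> and affine in \<open>w\<close>,
  which Taylor polynomials in \<open>z\<close> approximate uniformly.
\<close>

no_notation fps_nth (infixl \<open>$\<close> 75)

section \<open>Functions holomorphic near a compact set and their Taylor approximation\<close>

lemma hol_nbhd_const: "(\<lambda>_. c) \<in> hol_nbhd K"
  unfolding hol_nbhd_def by (auto intro!: exI[of _ UNIV])

text \<open>The two neighbourhoods need not agree, so one passes to their intersection. Since the
  last assumption is stated for every \<open>U\<close>, differences and products are both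
  instances.\<close>

lemma hol_nbhd_combine:
  assumes "f \<in> hol_nbhd K" "g \<in> hol_nbhd K"
    and "\<And>U. \<lbrakk>f holomorphic_on U; g holomorphic_on U\<rbrakk> \<Longrightarrow> h holomorphic_on U"
  shows "h \<in> hol_nbhd K"
proof -
  obtain U V where "open U" "K \<subseteq> U" "f holomorphic_on U" "open V" "K \<subseteq> V" "g holomorphic_on V"
    using assms(1,2) unfolding hol_nbhd_def by blast
  then have "open (U \<inter> V)" "K \<subseteq> U \<inter> V" "h holomorphic_on (U \<inter> V)"
    by (auto intro!: assms(3) elim: holomorphic_on_subset)
  then show ?thesis unfolding hol_nbhd_def by blast
qed

lemma hol_nbhd_diff:
  "f \<in> hol_nbhd K \<Longrightarrow> g \<in> hol_nbhd K \<Longrightarrow> (\<lambda>z. f z - g z) \<in> hol_nbhd K"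
  by (rule hol_nbhd_combine[of f K g]) (auto intro: holomorphic_intros)

lemma hol_nbhd_mult:
  "f \<in> hol_nbhd K \<Longrightarrow> g \<in> hol_nbhd K \<Longrightarrow> (\<lambda>z. f z * g z) \<in> hol_nbhd K"
  by (rule hol_nbhd_combine[of f K g]) (auto intro: holomorphic_intros)

text \<open>By compactness, \<open>U\<close> contains a uniform \<open>e\<close>-neighbourhood of
  the closed ball; radial projection shows that this neighbourhood contains the concentric ball of
  radius \<open>r + e\<close>.\<close>

lemma open_superset_cball_obtains_ball:
  fixes U :: "'a::euclidean_space set"
  assumes "open U" "cball a r \<subseteq> U" "r > 0"
  obtains R where "R > r" "ball a R \<subseteq> U"
proof -
  obtain e where e: "e > 0" "(\<Union>x\<in>cball a r. cball x e) \<subseteq> U"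
    using compact_subset_open_imp_cball_epsilon_subset[OF compact_cball assms(1,2)] by blast
  have "ball a (r + e) \<subseteq> (\<Union>x\<in>cball a r. cball x e)"
  proof
    fix x assume x: "x \<in> ball a (r + e)"
    show "x \<in> (\<Union>x\<in>cball a r. cball x e)"
    proof (cases "x \<in> cball a r")
      case True
      then show ?thesis using e(1) by (intro UN_I[of x]) auto
    next
      case False
      define d where "d = norm (x - a)"
      have d: "r < d" "d < r + e"
        using False x by (auto simp: d_def dist_norm norm_minus_commute)
      \<comment> \<open>The radial projection of \<open>x\<close> onto the sphere of radius
        \<open>r\<close>, at distance \<open>d - r < e\<close> from \<open>x\<close>.\<close>
      define y where "y = a + (r / d) *\<^sub>R (x - a)"
      have "x - y = (1 - r / d) *\<^sub>R (x - a)" unfolding y_def by (simp add: algebra_simps)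
      moreover have "0 \<le> 1 - r / d" using d assms(3) by simp
      ultimately have "norm (x - y) = (1 - r / d) * d" by (simp add: d_def)
      also have "\<dots> = d - r" using d assms(3) by (simp add: field_simps)
      finally have "x \<in> cball y e" using d by (simp add: dist_norm norm_minus_commute)
      moreover have "norm (y - a) = r" unfolding y_def using d assms(3) by (simp flip: d_def)
      then have "y \<in> cball a r" by (simp add: dist_norm norm_minus_commute)
      ultimately show ?thesis by blast
    qed
  qed
  with e that[of "r + e"] show thesis by auto
qed

text \<open>Holomorphy on a strictly larger disc makes the radius of convergence exceed
  \<open>r\<close>, so the Taylor sums at 0 converge uniformly on the closed disc.\<close>

lemma hol_nbhd_cball_approx:
  assumes "f \<in> hol_nbhd (cball 0 r)" "r > 0" "e > 0"
  obtains a :: "nat \<Rightarrow> complex" and n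
  where "\<And>z. z \<in> cball 0 r \<Longrightarrow> cmod ((\<Sum>i<n. a i * z ^ i) - f z) < e"
proof -
  obtain U where U: "open U" "cball 0 r \<subseteq> U" "f holomorphic_on U"
    using assms(1) unfolding hol_nbhd_def by blast
  obtain R where R: "R > r" "ball 0 R \<subseteq> U"
    using open_superset_cball_obtains_ball[OF U(1,2) assms(2)] .
  have hol: "f holomorphic_on eball 0 (ereal R)"
    using holomorphic_on_subset[OF U(3) R(2)] by simp
  define a where "a = fps_nth (fps_expansion f 0)"
  have "ereal R \<le> conv_radius a"
    using conv_radius_fps_expansion[OF hol] by (simp add: a_def fps_conv_radius_def)
  with R(1) have "ereal r < conv_radius a" by (metis ereal_less(2) less_ereal.simps(1) less_le_trans)
  from powser_uniform_limit[OF this, of 0]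
  have "uniform_limit (cball 0 r) (\<lambda>n z. \<Sum>i<n. a i * z ^ i) (\<lambda>z. \<Sum>i. a i * z ^ i) sequentially"
    by simp
  then have "eventually (\<lambda>n. \<forall>z\<in>cball 0 r. dist (\<Sum>i<n. a i * z ^ i) (\<Sum>i. a i * z ^ i) < e) sequentially"
    using \<open>e > 0\<close> by (rule uniform_limitD)
  then obtain n where n: "\<forall>z\<in>cball 0 r. dist (\<Sum>i<n. a i * z ^ i) (\<Sum>i. a i * z ^ i) < e"
    using eventually_happens'[OF sequentially_bot] by blast
  have "(\<Sum>i. a i * z ^ i) = f z" if "z \<in> cball 0 r" for z
    using eval_fps_expansion'[OF hol, of z] that R(1) by (simp add: eval_fps_def a_def)
  with n show thesis by (intro that[of a n]) (simp add: dist_norm)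
qed

section \<open>Holomorphic polynomials\<close>

lemma holomorphic_polynomial_monomial:
  "holomorphic_polynomial (\<lambda>x. c * (\<Prod>i\<in>UNIV. (x $ i) ^ \<alpha> i))"
  unfolding holomorphic_polynomial_def by (intro exI[of _ "{\<alpha>}"] exI[of _ "\<lambda>_. c"]) simp

lemma holomorphic_polynomial_add:
  assumes "holomorphic_polynomial q" "holomorphic_polynomial s"
  shows "holomorphic_polynomial (\<lambda>x. q x + s x)"
proof -
  obtain S c where S: "finite S" "\<And>x. q x = (\<Sum>\<alpha>\<in>S. c \<alpha> * (\<Prod>i\<in>UNIV. (x $ i) ^ \<alpha> i))"
    using assms(1) unfolding holomorphic_polynomial_def by blast
  obtain T d where T: "finite T" "\<And>x. s x = (\<Sum>\<alpha>\<in>T. d \<alpha> * (\<Prod>i\<in>UNIV. (x $ i) ^ \<alpha> i))"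
    using assms(2) unfolding holomorphic_polynomial_def by blast
  \<comment> \<open>Both coefficient families are extended by zero, so that the two sums run over
    the common index set \<open>S \<union> T\<close>.\<close>
  define e where "e \<alpha> = (if \<alpha> \<in> S then c \<alpha> else 0) + (if \<alpha> \<in> T then d \<alpha> else 0)" for \<alpha>
  have "q x + s x = (\<Sum>\<alpha>\<in>S \<union> T. e \<alpha> * (\<Prod>i\<in>UNIV. (x $ i) ^ \<alpha> i))" for x
  proof -
    have "q x = (\<Sum>\<alpha>\<in>S \<union> T. (if \<alpha> \<in> S then c \<alpha> else 0) * (\<Prod>i\<in>UNIV. (x $ i) ^ \<alpha> i))"
      unfolding S(2) using S(1) T(1) by (intro sum.mono_neutral_cong_left) auto
    moreover have "s x = (\<Sum>\<alpha>\<in>S \<union> T. (if \<alpha> \<in> T then d \<alpha> else 0) * (\<Prod>i\<in>UNIV. (x $ i) ^ \<alpha> i))"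
      unfolding T(2) using S(1) T(1) by (intro sum.mono_neutral_cong_left) auto
    ultimately show ?thesis
      by (simp only: e_def distrib_right sum.distrib)
  qed
  with S(1) T(1) show ?thesis unfolding holomorphic_polynomial_def by blast
qed

lemma holomorphic_polynomial_const: "holomorphic_polynomial (\<lambda>_. c)"
  using holomorphic_polynomial_monomial[of c "\<lambda>_. 0"] by simp

lemma holomorphic_polynomial_sum:
  "(\<And>i. i \<in> I \<Longrightarrow> holomorphic_polynomial (q i)) \<Longrightarrow> holomorphic_polynomial (\<lambda>x. \<Sum>i\<in>I. q i x)"
  by (induction I rule: infinite_finite_induct)
    (auto intro: holomorphic_polynomial_const holomorphic_polynomial_add)

lemma holomorphic_polynomial_monomial_2:
  "holomorphic_polynomial (\<lambda>x :: complex ^ 2. c * ((x $ 1) ^ k * (x $ 2) ^ l))"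
  using holomorphic_polynomial_monomial[of c "\<lambda>i :: 2. if i = 1 then k else l"]
  by (simp add: UNIV_2)

section \<open>Estimates on polynomially convex hulls\<close>

lemma poly_hull_norm_le:
  assumes "x \<in> poly_hull X" "X \<noteq> {}" "holomorphic_polynomial q" "\<And>y. y \<in> X \<Longrightarrow> cmod (q y) \<le> M"
  shows "cmod (q x) \<le> M"
proof -
  have "cmod (q x) \<le> (SUP y\<in>X. cmod (q y))" using assms unfolding poly_hull_def by blast
  also have "\<dots> \<le> M" using assms by (intro cSUP_least) auto
  finally show ?thesis .
qed

text \<open>
  The half plane \<open>Re \<le> e\<close> is exhausted by large discs: a bound \<open>|q + N|\<close> on \<open>X\<close> carries
  over to the hull, and \<open>N \<rightarrow> \<infinity>\<close> isolates the real part.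
\<close>

lemma poly_hull_Re_le:
  assumes x: "x \<in> poly_hull X" "X \<noteq> {}" and q: "holomorphic_polynomial q"
    and M: "\<And>y. y \<in> X \<Longrightarrow> cmod (q y) \<le> M" and Re: "\<And>y. y \<in> X \<Longrightarrow> Re (q y) \<le> e"
  shows "Re (q x) \<le> e"
proof (rule ccontr)
  assume contra: "\<not> Re (q x) \<le> e"
  define d where "d = Re (q x) - e"
  have d: "d > 0" using contra by (simp add: d_def)
  \<comment> \<open>Chosen so that \<open>N * d\<close> is at least \<open>M\<^sup>2 + 1\<close>:
    comparing squared moduli at \<open>x\<close> will force
    \<open>2 * (N * d) \<le> M\<^sup>2\<close>.\<close>
  define N where "N = (M\<^sup>2 + 1) / d + \<bar>Re (q x)\<bar>"
  have "(M\<^sup>2 + 1) / d \<ge> 0" using d by simp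
  then have N: "N \<ge> 0" by (simp add: N_def)
  have "N * d = M\<^sup>2 + 1 + \<bar>Re (q x)\<bar> * d" using d by (simp add: N_def field_simps)
  then have Nd: "N * d \<ge> M\<^sup>2 + 1" using d by simp
  have Nq: "holomorphic_polynomial (\<lambda>y. q y + complex_of_real N)"
    by (intro holomorphic_polynomial_add holomorphic_polynomial_const q)
  have *: "(cmod (q y + complex_of_real N))\<^sup>2 \<le> N\<^sup>2 + 2 * N * e + M\<^sup>2" if "y \<in> X" for y
  proof -
    have "(cmod (q y + complex_of_real N))\<^sup>2 = N\<^sup>2 + 2 * N * Re (q y) + (cmod (q y))\<^sup>2"
      unfolding cmod_power2 by (simp add: power2_eq_square algebra_simps)
    also have "\<dots> \<le> N\<^sup>2 + 2 * N * e + M\<^sup>2"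
      using Re[OF that] M[OF that] N by (intro add_mono mult_left_mono power_mono) auto
    finally show ?thesis .
  qed
  have "cmod (q x + complex_of_real N) \<le> sqrt (N\<^sup>2 + 2 * N * e + M\<^sup>2)"
    using * by (intro poly_hull_norm_le[OF x Nq] real_le_rsqrt)
  \<comment> \<open>Undoing the square root needs a nonnegative radicand; \<open>*\<close> at any
    point of the nonempty \<open>X\<close> supplies it.\<close>
  moreover have "0 \<le> N\<^sup>2 + 2 * N * e + M\<^sup>2" using * x(2) by (meson equals0I order_trans zero_le_power2)
  ultimately have "(cmod (q x + complex_of_real N))\<^sup>2 \<le> N\<^sup>2 + 2 * N * e + M\<^sup>2"
    by (metis norm_ge_zero power_mono real_sqrt_pow2)
  moreover have "(N + Re (q x))\<^sup>2 \<le> (cmod (q x + complex_of_real N))\<^sup>2"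
    by (simp add: cmod_power2 add.commute)
  ultimately have "2 * (N * d) + (Re (q x))\<^sup>2 \<le> M\<^sup>2"
    by (simp add: d_def power2_eq_square algebra_simps)
  with Nd show False by (smt (verit) zero_le_power2)
qed

section \<open>The hull of a graph over a closed disc\<close>

lemma poly_hull_graph_fst:
  fixes x :: "complex ^ 2"
  assumes "x \<in> poly_hull (graph_over (cball 0 r) F)" "r > 0"
  shows "x $ 1 \<in> cball 0 r"
proof -
  \<comment> \<open>The test polynomial is the first coordinate, written as a monomial; on the graph
    its modulus is at most \<open>r\<close>.\<close>
  have "cmod (1 * ((x $ 1) ^ 1 * (x $ 2) ^ 0)) \<le> r"
    using assms
    by (intro poly_hull_norm_le[OF assms(1) _ holomorphic_polynomial_monomial_2])
      (auto simp: graph_over_def intro: exI[of _ 0])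
  then show ?thesis by simp
qed

text \<open>Taylor polynomials for \<open>a\<close> and \<open>b\<close> turn the expression into a
  polynomial up to a small error, so the bound on the real part passes from the graph to the hull;
  the slack \<open>d\<close> absorbs the error.\<close>

lemma poly_hull_graph_Re_affine:
  fixes x :: "complex ^ 2"
  assumes x: "x \<in> poly_hull (graph_over (cball 0 r) F)" and r: "r > 0"
    and F: "continuous_on (cball 0 r) F"
    and hol: "a \<in> hol_nbhd (cball 0 r)" "b \<in> hol_nbhd (cball 0 r)"
    and Re: "\<And>z. z \<in> cball 0 r \<Longrightarrow> Re (a z * F z + b z) \<le> 0"
  shows "Re (a (x $ 1) * x $ 2 + b (x $ 1)) \<le> 0"
proof (rule field_le_epsilon)
  fix d :: real assume d: "d > 0"
  have "bounded (F ` cball 0 r)"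
    by (intro compact_imp_bounded compact_continuous_image F compact_cball)
  then obtain B where B: "\<And>z. z \<in> cball 0 r \<Longrightarrow> cmod (F z) \<le> B"
    by (force simp: bounded_iff)
  \<comment> \<open>\<open>C\<close> dominates both \<open>F\<close> on the disc and the second
    coordinate of \<open>x\<close>, so one error bound \<open>e * (C + 1)\<close> serves on the
    graph and at the hull point.\<close>
  define C where "C = \<bar>B\<bar> + cmod (x $ 2) + 1"
  have C: "C \<ge> 1" "cmod (x $ 2) \<le> C" "\<And>z. z \<in> cball 0 r \<Longrightarrow> cmod (F z) \<le> C"
    using B unfolding C_def by (force, force, smt (verit) norm_ge_zero)
  \<comment> \<open>The error enters twice, once on the graph and once at \<open>x\<close>; the two
    together amount to \<open>d\<close>.\<close>
  define e where "e = d / (2 * (C + 1))"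
  have e: "e > 0" "2 * (e * (C + 1)) = d" using d C(1) by (auto simp: e_def field_simps)
  obtain s m where s: "\<And>z. z \<in> cball 0 r \<Longrightarrow> cmod ((\<Sum>i<m. s i * z ^ i) - a z) < e"
    using hol_nbhd_cball_approx[OF hol(1) r e(1)] by metis
  obtain t n where t: "\<And>z. z \<in> cball 0 r \<Longrightarrow> cmod ((\<Sum>i<n. t i * z ^ i) - b z) < e"
    using hol_nbhd_cball_approx[OF hol(2) r e(1)] by metis
  define q where "q = (\<lambda>y :: complex ^ 2. (\<Sum>i<m. s i * (y $ 1) ^ i) * y $ 2 + (\<Sum>i<n. t i * (y $ 1) ^ i))"
  have "holomorphic_polynomial (\<lambda>y :: complex ^ 2. (\<Sum>i<m. s i * ((y $ 1) ^ i * (y $ 2) ^ 1))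
      + (\<Sum>i<n. t i * ((y $ 1) ^ i * (y $ 2) ^ 0)))"
    by (rule holomorphic_polynomial_add; rule holomorphic_polynomial_sum; rule holomorphic_polynomial_monomial_2)
  then have q: "holomorphic_polynomial q"
    by (simp add: q_def sum_distrib_right mult.assoc)
  have close: "cmod (q (vector [z, w]) - (a z * w + b z)) \<le> e * (C + 1)"
    if "z \<in> cball 0 r" "cmod w \<le> C" for z w
  proof -
    have "q (vector [z, w]) - (a z * w + b z)
        = ((\<Sum>i<m. s i * z ^ i) - a z) * w + ((\<Sum>i<n. t i * z ^ i) - b z)"
      by (simp add: q_def algebra_simps)
    also have "cmod \<dots> \<le> cmod ((\<Sum>i<m. s i * z ^ i) - a z) * cmod w + cmod ((\<Sum>i<n. t i * z ^ i) - b z)"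
      by (rule norm_triangle_ineq[THEN order_trans]) (simp add: norm_mult)
    also have "\<dots> \<le> e * C + e"
      using s[OF that(1)] t[OF that(1)] that(2) e(1) by (intro add_mono mult_mono) (auto intro: less_imp_le)
    finally show ?thesis by (simp add: algebra_simps)
  qed
  have closeRe: "\<bar>Re (q (vector [z, w])) - Re (a z * w + b z)\<bar> \<le> e * (C + 1)"
    if "z \<in> cball 0 r" "cmod w \<le> C" for z w
    using close[OF that] abs_Re_le_cmod[of "q (vector [z, w]) - (a z * w + b z)"] by simp
  have "continuous_on (cball 0 r) (\<lambda>z. q (vector [z, F z]))"
    unfolding q_def using F by (auto intro!: continuous_intros)
  then have "bounded ((\<lambda>z. q (vector [z, F z])) ` cball 0 r)"
    by (intro compact_imp_bounded compact_continuous_image compact_cball)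
  then obtain M where M: "\<And>z. z \<in> cball 0 r \<Longrightarrow> cmod (q (vector [z, F z])) \<le> M"
    by (force simp: bounded_iff)
  have "Re (q (vector [x $ 1, x $ 2])) = Re (q x)" by (simp add: q_def)
  moreover have "Re (q x) \<le> e * (C + 1)"
  proof (rule poly_hull_Re_le[OF x _ q, of M])
    show "graph_over (cball 0 r) F \<noteq> {}" using r by (auto simp: graph_over_def intro: exI[of _ 0])
    fix y assume "y \<in> graph_over (cball 0 r) F"
    then obtain z where z: "z \<in> cball 0 r" and y: "y = vector [z, F z]"
      by (auto simp: graph_over_def)
    show "cmod (q y) \<le> M" using M[OF z] y by simp
    show "Re (q y) \<le> e * (C + 1)" using closeRe[OF z C(3)[OF z]] Re[OF z] unfolding y by linarith
  qed
  ultimately show "Re (a (x $ 1) * x $ 2 + b (x $ 1)) \<le> 0 + d"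
    using closeRe[OF poly_hull_graph_fst[OF x r] C(2)] e(2) by linarith
qed

section \<open>The tangent inequality and the conclusion\<close>

lemma powr_tangent_le:
  fixes p u v :: real
  assumes "p > 1" "u \<ge> 0" "v \<ge> 0"
  shows "p * v powr (p - 1) * u - (p - 1) * v powr p \<le> u powr p"
proof -
  \<comment> \<open>Young's inequality with exponents \<open>p\<close> and
    \<open>p / (p - 1)\<close>. Multiplied by \<open>p\<close>, it says that the graph of
    \<open>t powr p\<close> lies above its tangent at \<open>v\<close>.\<close>
  have "u * v powr (p - 1) \<le> u powr p / p + (v powr (p - 1)) powr (p / (p - 1)) / (p / (p - 1))"
    using assms by (intro Youngs_inequality) (auto simp: field_simps)
  also have "(v powr (p - 1)) powr (p / (p - 1)) = v powr p"
    using assms by (simp add: powr_powr)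
  finally show ?thesis using assms by (simp add: field_simps)
qed

theorem proposition1p7:
  fixes r p :: real and \<zeta> :: complex and F A G H :: "complex \<Rightarrow> complex"
  assumes "r > 0"
    and "continuous_on (cball 0 r) F"
    and "\<zeta> \<in> cball 0 r"
    and "p \<ge> 2"
    and "A \<in> hol_nbhd (cball 0 r)"
    and "\<And>z. z \<in> cball 0 r \<Longrightarrow> A z \<noteq> 0"
    and "G \<in> hol_nbhd_vanishing \<zeta> (cball 0 r)"
    and "H \<in> hol_nbhd_vanishing \<zeta> (cball 0 r)"
    and "\<And>z. z \<in> cball 0 r \<Longrightarrow>
           cmod (A z * F z - A \<zeta> * F \<zeta> + G z) powr p
             \<le> Re (H z * (A z * F z - A \<zeta> * F \<zeta> + G z))"
  shows "poly_hull (graph_over (cball 0 r) F) \<subseteq>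
           {vector [z, w] | z w. z \<in> cball 0 r \<and>
              cmod (A z * w - A \<zeta> * F \<zeta> + G z) \<le> cmod (H z) powr (1 / (p - 1))}"
proof
  fix x :: "complex ^ 2"
  assume x: "x \<in> poly_hull (graph_over (cball 0 r) F)"
  define c where "c = A \<zeta> * F \<zeta>"
  define W where "W z w = A z * w - c + G z" for z w
  define z0 where "z0 = x $ 1"
  define W0 where "W0 = W z0 (x $ 2)"
  have z0: "z0 \<in> cball 0 r" unfolding z0_def using poly_hull_graph_fst x assms(1) by blast
  have G: "G \<in> hol_nbhd (cball 0 r)" and H: "H \<in> hol_nbhd (cball 0 r)"
    using assms(7,8) by (auto simp: hol_nbhd_vanishing_def)
  have "cmod W0 \<le> cmod (H z0) powr (1 / (p - 1))"
  proof (cases "W0 = 0")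
    case False
    \<comment> \<open>\<open>Re (b * W) - k\<close> is the real-affine tangent of
      \<open>cmod W powr p\<close> at \<open>W0\<close>: it lies below everywhere and agrees at
      \<open>W0\<close>.\<close>
    define k where "k = (p - 1) * cmod W0 powr p"
    define b where "b = complex_of_real (p * cmod W0 powr (p - 2)) * cnj W0"
    have powr_Suc: "cmod W0 powr (s - 1) * cmod W0 = cmod W0 powr s" for s
      using False powr_add[of "cmod W0" "s - 1" 1] by simp
    have norm_b: "cmod b = p * cmod W0 powr (p - 1)"
      using powr_Suc[of "p - 1"] assms(4) by (simp add: b_def norm_mult)
    have "b * W0 = complex_of_real (p * cmod W0 powr (p - 2) * (cmod W0 * cmod W0))"
      by (simp add: b_def mult.assoc mult.commute[of "cnj W0"] flip: complex_norm_square power2_eq_square)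
    also have "cmod W0 powr (p - 2) * (cmod W0 * cmod W0) = cmod W0 powr p"
      using powr_Suc[of "p - 1"] powr_Suc[of p] by (simp flip: mult.assoc)
    then have "p * cmod W0 powr (p - 2) * (cmod W0 * cmod W0) = p * cmod W0 powr p"
      by (simp only: mult.assoc)
    finally have bW0: "b * W0 = complex_of_real (p * cmod W0 powr p)" .
    \<comment> \<open>This is \<open>Re (b * W - H * W - k)\<close> sorted by powers of
      \<open>w\<close>, the form to which \<open>poly_hull_graph_Re_affine\<close> applies.\<close>
    have "Re ((b - H z0) * A z0 * x $ 2 + ((b - H z0) * (G z0 - c) - complex_of_real k)) \<le> 0"
      unfolding z0_def
    proof (rule poly_hull_graph_Re_affine[OF x assms(1,2)])
      show "(\<lambda>z. (b - H z) * A z) \<in> hol_nbhd (cball 0 r)"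
        by (intro hol_nbhd_mult hol_nbhd_diff hol_nbhd_const H assms(5))
      show "(\<lambda>z. (b - H z) * (G z - c) - complex_of_real k) \<in> hol_nbhd (cball 0 r)"
        by (intro hol_nbhd_mult hol_nbhd_diff hol_nbhd_const H G)
      fix z :: complex
      assume z: "z \<in> cball 0 r"
      have "Re (b * W z (F z)) - k \<le> cmod b * cmod (W z (F z)) - k"
        using complex_Re_le_cmod[of "b * W z (F z)"] by (simp add: norm_mult)
      also have "\<dots> \<le> cmod (W z (F z)) powr p"
        using powr_tangent_le[of p "cmod (W z (F z))" "cmod W0"] assms(4) by (simp add: norm_b k_def)
      also have "\<dots> \<le> Re (H z * W z (F z))"
        using assms(9)[OF z] by (simp add: W_def c_def)
      finally have "Re (b * W z (F z) - H z * W z (F z) - complex_of_real k) \<le> 0" by simp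
      also have "b * W z (F z) - H z * W z (F z) - complex_of_real k
          = (b - H z) * A z * F z + ((b - H z) * (G z - c) - complex_of_real k)"
        by (simp add: W_def algebra_simps)
      finally show "Re ((b - H z) * A z * F z + ((b - H z) * (G z - c) - complex_of_real k)) \<le> 0" .
    qed
    also have "(b - H z0) * A z0 * x $ 2 + ((b - H z0) * (G z0 - c) - complex_of_real k)
        = b * W0 - H z0 * W0 - complex_of_real k"
      by (simp add: W0_def W_def algebra_simps)
    \<comment> \<open>The tangent touches at \<open>W0\<close>, so \<open>b * W0 - k\<close> equals
      \<open>cmod W0 powr p\<close> and nothing is lost by linearizing.\<close>
    finally have "cmod W0 powr p \<le> Re (H z0 * W0)"
      unfolding bW0 by (simp add: k_def algebra_simps)
    also have "\<dots> \<le> cmod (H z0) * cmod W0"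
      using complex_Re_le_cmod[of "H z0 * W0"] by (simp only: norm_mult)
    \<comment> \<open>One factor \<open>cmod W0\<close>, nonzero in this case, is cancelled; the
      root of order \<open>p - 1\<close> follows.\<close>
    finally have "cmod W0 powr (p - 1) \<le> cmod (H z0)"
      using False by (simp flip: powr_Suc[of p])
    then have "(cmod W0 powr (p - 1)) powr (1 / (p - 1)) \<le> cmod (H z0) powr (1 / (p - 1))"
      using assms(4) by (intro powr_mono2) auto
    then show ?thesis using assms(4) False by (simp add: powr_powr)
  qed simp
  then have "cmod (A z0 * x $ 2 - A \<zeta> * F \<zeta> + G z0) \<le> cmod (H z0) powr (1 / (p - 1))"
    by (simp add: W0_def W_def c_def)
  moreover have "x = vector [z0, x $ 2]"
    by (simp add: vec_eq_iff forall_2 z0_def)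
  ultimately show "x \<in> {vector [z, w] | z w. z \<in> cball 0 r \<and>
              cmod (A z * w - A \<zeta> * F \<zeta> + G z) \<le> cmod (H z) powr (1 / (p - 1))}"
    using z0 by blast
qed

end
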